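(* Consider online Nash welfare maximization with $N$ agents and divisible items arriving online, and let $\lambda^*$ denote the balance ratio of the instance (not known to the algorithm). The following randomized online algorithm (Half-and-Half with a guessed balance bound) is $O\big(\log(\lambda^* N)\,(\log\log \lambda^* )^2\big)$-competitive: before any item arrives, sample a non-negative integer $k$ with probability $\frac{6}{\pi^2}\cdot\frac{1}{(k+1)^2}$, set $\lambda = 2^{2^k}$, and then run the Half-and-Half algorithm with parameter $\lambda$ to allocate all items.
   Context: There are $N$ agents and $T$ divisible items arriving online in the order $t=1,\dots,T$. Item $t$ has supply $s_t>0$ and agent $i$ has value $v_{it}\ge 0$ per unit of item $t$. An allocation is a non-negative vector $(x_{it})$ with $\sum_{i} x_{it}\le s_t$ for every $t$; agent $i$'s utility is $u_i=\sum_t x_{it}v_{it}$, and the Nash welfare is $(\prod_{i=1}^N u_i)^{1/N}$. When item $t$ arrives, an online algorithm observes $s_t$ and $(v_{it})_{i}$ and must irrevocably decide how to allocate item $t$. An algorithm is $\Gamma$-competitive if on every instance, the optimal (offline) Nash welfare is at most $\Gamma$ times the expected Nash welfare of the algorithm's allocation. The monopolist utility of agent $i$ is $V_i=\sum_{t=1}^T s_t v_{it}$; the balance ratio is $\lambda^*=\max_i V_i/\min_i V_i$. Logarithms are natural. Half-and-Half with parameter $\lambda$: for each item $t$ in order, let $y_{it}=\frac{s_t}{2N}$ for all $i$; define the anticipated utilities $u'_{it}=\frac{1}{2\lambda N^2}\sum_{j=1}^N\sum_{t'=1}^{t} v_{jt'}s_{t'}+\sum_{t'=1}^{t-1} v_{it'}z_{it'}$;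 let $(z_{it})_i$ maximize $\sum_{i=1}^N\log(u'_{it}+v_{it}z_{it})$ subject to $\sum_i z_{it}\le s_t/2$ and $z_{it}\ge 0$; allocate $x_{it}=y_{it}+z_{it}$ to each agent $i$. *)

theory Defs
  imports "HOL-Probability.Probability"
begin

(* Agents are {..<N}, items are {..<T} (item t + 1 of the usual numbering is t).  The supplies are
   s t, the values per unit are v i t and an allocation is x i t.  Entries outside of these ranges
   are never inspected. *)

definition nw_instance :: "nat \<Rightarrow> nat \<Rightarrow> (nat \<Rightarrow> real) \<Rightarrow> (nat \<Rightarrow> nat \<Rightarrow> real) \<Rightarrow> bool" where
  "nw_instance N T s v \<longleftrightarrow>
     N \<ge> 1 \<and> (\<forall>t<T. s t > 0) \<and> (\<forall>i<N. \<forall>t<T. v i t \<ge> 0)"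

definition feasible_allocation :: "nat \<Rightarrow> nat \<Rightarrow> (nat \<Rightarrow> real) \<Rightarrow> (nat \<Rightarrow> nat \<Rightarrow> real) \<Rightarrow> bool" where
  "feasible_allocation N T s x \<longleftrightarrow>
     (\<forall>i<N. \<forall>t<T. x i t \<ge> 0) \<and> (\<forall>t<T. (\<Sum>i<N. x i t) \<le> s t)"

definition utility :: "nat \<Rightarrow> (nat \<Rightarrow> nat \<Rightarrow> real) \<Rightarrow> (nat \<Rightarrow> nat \<Rightarrow> real) \<Rightarrow> nat \<Rightarrow> real" where
  "utility T v x i = (\<Sum>t<T. x i t * v i t)"

definition nash_welfare :: "nat \<Rightarrow> nat \<Rightarrow> (nat \<Rightarrow> nat \<Rightarrow> real) \<Rightarrow> (nat \<Rightarrow> nat \<Rightarrow> real) \<Rightarrow> real" where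
  "nash_welfare N T v x = root N (\<Prod>i<N. utility T v x i)"

definition opt_nash_welfare :: "nat \<Rightarrow> nat \<Rightarrow> (nat \<Rightarrow> real) \<Rightarrow> (nat \<Rightarrow> nat \<Rightarrow> real) \<Rightarrow> real" where
  "opt_nash_welfare N T s v = (SUP x\<in>{x. feasible_allocation N T s x}. nash_welfare N T v x)"

definition monopolist_utility :: "nat \<Rightarrow> (nat \<Rightarrow> real) \<Rightarrow> (nat \<Rightarrow> nat \<Rightarrow> real) \<Rightarrow> nat \<Rightarrow> real" where
  "monopolist_utility T s v i = (\<Sum>t<T. s t * v i t)"

(* If some agent values nothing, the ratio is infinite, whereas the quotient below is 0.  This is
   harmless for competitiveness: the optimal Nash welfare is then 0, so every nonnegative bound
   on the ratio is correct for the instance. *)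
definition balance_ratio :: "nat \<Rightarrow> nat \<Rightarrow> (nat \<Rightarrow> real) \<Rightarrow> (nat \<Rightarrow> nat \<Rightarrow> real) \<Rightarrow> real" where
  "balance_ratio N T s v =
     Max (monopolist_utility T s v ` {..<N}) / Min (monopolist_utility T s v ` {..<N})"

definition anticipated_utility ::
  "nat \<Rightarrow> (nat \<Rightarrow> real) \<Rightarrow> (nat \<Rightarrow> nat \<Rightarrow> real) \<Rightarrow> real \<Rightarrow> (nat \<Rightarrow> nat \<Rightarrow> real) \<Rightarrow> nat \<Rightarrow> nat \<Rightarrow> real" where
  "anticipated_utility N s v lam z i t =
     1 / (2 * lam * real N ^ 2) * (\<Sum>j<N. \<Sum>t'\<le>t. v j t' * s t') + (\<Sum>t'<t. v i t' * z i t')"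

(* z is the greedy half of a run of Half-and-Half with parameter lam.  The column of z for item t
   is constrained only through s, v and z at items up to t.  Any maximizer is admitted at each
   step, so statements about all runs hold for every tie-breaking rule.

   The arguments of ln are positive as soon as some agent has positive value for some item up
   to t.  Otherwise v i t = 0 for all i and the objective does not depend on the competitor, so
   that the value of ln at 0 is immaterial. *)
definition half_and_half_run ::
  "nat \<Rightarrow> nat \<Rightarrow> (nat \<Rightarrow> real) \<Rightarrow> (nat \<Rightarrow> nat \<Rightarrow> real) \<Rightarrow> real \<Rightarrow> (nat \<Rightarrow> nat \<Rightarrow> real) \<Rightarrow> bool" where
  "half_and_half_run N T s v lam z \<longleftrightarrow>
     (\<forall>t<T. is_arg_max
        (\<lambda>w. \<Sum>i<N. ln (anticipated_utility N s v lam z i t + v i t * w i))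
        (\<lambda>w. (\<forall>i<N. w i \<ge> 0) \<and> (\<Sum>i<N. w i) \<le> s t / 2)
        (\<lambda>i. z i t))"

definition half_and_half_allocation ::
  "nat \<Rightarrow> (nat \<Rightarrow> real) \<Rightarrow> (nat \<Rightarrow> nat \<Rightarrow> real) \<Rightarrow> nat \<Rightarrow> nat \<Rightarrow> real" where
  "half_and_half_allocation N s z i t = s t / (2 * real N) + z i t"

definition guess_pmf :: "nat pmf" where
  "guess_pmf = embed_pmf (\<lambda>k. 6 / pi ^ 2 * (1 / (real k + 1) ^ 2))"

(* A randomized algorithm is represented by the relation between instances and the possible
   distributions of its allocation; several distributions are possible only because of ties. *)
type_synonym randomized_algorithm =
  "nat \<Rightarrow> nat \<Rightarrow> (nat \<Rightarrow> real) \<Rightarrow> (nat \<Rightarrow> nat \<Rightarrow> real) \<Rightarrow> (nat \<Rightarrow> nat \<Rightarrow> real) pmf \<Rightarrow> bool"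

definition guessing_half_and_half :: randomized_algorithm where
  "guessing_half_and_half N T s v D \<longleftrightarrow>
     (\<exists>z. (\<forall>k. half_and_half_run N T s v (2 ^ (2 ^ k)) (z k)) \<and>
          D = map_pmf (\<lambda>k. half_and_half_allocation N s (z k)) guess_pmf)"

definition competitive ::
  "(nat \<Rightarrow> nat \<Rightarrow> (nat \<Rightarrow> real) \<Rightarrow> (nat \<Rightarrow> nat \<Rightarrow> real) \<Rightarrow> real) \<Rightarrow> randomized_algorithm \<Rightarrow> bool" where
  "competitive \<Gamma> alg \<longleftrightarrow>
     (\<forall>N T s v D. nw_instance N T s v \<longrightarrow> alg N T s v D \<longrightarrow>
        opt_nash_welfare N T s v
          \<le> \<Gamma> N T s v * measure_pmf.expectation D (nash_welfare N T v))"

(* The logarithm inside O-bounds that are to hold on every instance: ln (ln x) is 0 at x = exp 1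
   and undefined at x = 1.  For x >= exp (exp 1), log_bound (log_bound x) = ln (ln x). *)
definition log_bound :: "real \<Rightarrow> real" where
  "log_bound x = max 1 (ln x)"


lemma pmf_guess_pmf: "pmf guess_pmf k = 6 / pi ^ 2 * (1 / (real k + 1) ^ 2)"
proof -
  have S: "(\<lambda>k. 6 / pi ^ 2 * (1 / (real k + 1) ^ 2)) sums (6 / pi ^ 2 * (pi ^ 2 / 6))"
    by (intro sums_mult) (use inverse_squares_sums in \<open>simp add: add.commute\<close>)
  have "(\<integral>\<^sup>+k. ennreal (6 / pi ^ 2 * (1 / (real k + 1) ^ 2)) \<partial>count_space UNIV) = 1"
    using S by (subst nn_integral_count_space_nat, subst suminf_ennreal_eq[OF _ S]) auto
  then show ?thesis
    unfolding guess_pmf_def by (subst pmf_embed_pmf) auto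
qed

lemma nash_welfare_le_opt:
  assumes "nw_instance N T s v" "feasible_allocation N T s x"
  shows "nash_welfare N T v x \<le> opt_nash_welfare N T s v"
proof -
  have *: "nash_welfare N T v y \<le> root N (\<Prod>i<N. monopolist_utility T s v i)"
    if y: "feasible_allocation N T s y" for y
  proof -
    have "0 \<le> utility T v y i \<and> utility T v y i \<le> monopolist_utility T s v i" if "i < N" for i
    proof -
      have "y i t \<le> s t" if "t < T" for t
      proof -
        have "y i t \<le> (\<Sum>i<N. y i t)"
          using y \<open>i < N\<close> that by (intro member_le_sum) (auto simp: feasible_allocation_def)
        with y that show ?thesis by (force simp: feasible_allocation_def)
      qed
      with y assms(1) that show ?thesis
        unfolding utility_def monopolist_utility_def
        by (auto intro!: sum_nonneg sum_mono mult_right_mono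
            simp: nw_instance_def feasible_allocation_def)
    qed
    with assms(1) show ?thesis
      unfolding nash_welfare_def nw_instance_def
      by (intro real_root_le_mono prod_mono) auto
  qed
  show ?thesis
    unfolding opt_nash_welfare_def
    by (rule cSUP_upper) (use assms(2) * in \<open>auto intro!: bdd_aboveI2\<close>)
qed

lemma half_and_half_step_exists:
  fixes a :: "nat \<Rightarrow> real" and u :: "nat \<Rightarrow> real"
  assumes "c \<ge> 0" and "\<And>i. i < N \<Longrightarrow> a i \<ge> 0"
    and "(\<forall>i<N. u i > 0) \<or> (\<forall>i<N. a i = 0)"
  shows "\<exists>w. is_arg_max (\<lambda>w. \<Sum>i<N. ln (u i + a i * w i))
    (\<lambda>w. (\<forall>i<N. w i \<ge> 0) \<and> (\<Sum>i<N. w i) \<le> c) w"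
    (is "\<exists>w. is_arg_max ?f ?P w")
  using assms(3)
proof
  assume "\<forall>i<N. a i = 0"
  with \<open>c \<ge> 0\<close> show ?thesis
    by (intro exI[of _ "\<lambda>_. 0"]) (auto simp: is_arg_max_def)
next
  assume u: "\<forall>i<N. u i > 0"
  define K where "K = (PiE UNIV (\<lambda>i::nat. if i < N then {0..c} else {0}))"
  define S where "S = K \<inter> {w. (\<Sum>i<N. w i) \<le> c}"
  have "compactin (product_topology (\<lambda>_. euclidean) UNIV) K"
    unfolding K_def by (subst compactin_PiE) auto
  then have "compact K"
    by (simp add: euclidean_product_topology)
  moreover have "closed {w :: nat \<Rightarrow> real. (\<Sum>i<N. w i) \<le> c}"
    by (intro closed_Collect_le continuous_intros continuous_on_product_coordinates)
  ultimately have "compact S"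
    unfolding S_def by (rule compact_Int_closed)
  moreover have "(\<lambda>_. 0) \<in> S"
    using \<open>c \<ge> 0\<close> by (auto simp: S_def K_def)
  moreover have "continuous_on S ?f"
  proof (intro continuous_intros continuous_on_subset[OF continuous_on_product_coordinates])
    show "\<forall>w\<in>S. u i + a i * w i \<noteq> 0" if "i \<in> {..<N}" for i
    proof
      fix w assume "w \<in> S"
      with that have "w i \<ge> 0"
        by (auto simp: S_def K_def PiE_iff dest!: spec[of _ i])
      with that u assms(2) show "u i + a i * w i \<noteq> 0"
        by (smt (verit) lessThan_iff mult_nonneg_nonneg)
    qed
  qed auto
  ultimately obtain w where w: "w \<in> S" "\<And>w'. w' \<in> S \<Longrightarrow> ?f w' \<le> ?f w"
    using continuous_attains_sup[of S ?f] by blast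
  have "?P w"
    using w(1) by (auto simp: S_def K_def PiE_iff split: if_splits)
  moreover have "?f w' \<le> ?f w" if "?P w'" for w'
  proof -
    have "w' i \<le> c" if "i < N" for i
    proof -
      have "w' i \<le> (\<Sum>i<N. w' i)"
        using \<open>?P w'\<close> that by (intro member_le_sum) auto
      with \<open>?P w'\<close> show ?thesis by linarith
    qed
    with that have "(\<lambda>i. if i < N then w' i else 0) \<in> S"
      by (auto simp: S_def K_def)
    from w(2)[OF this] show ?thesis by simp
  qed
  ultimately show ?thesis
    by (intro exI[of _ w]) (auto simp: is_arg_max_def not_less)
qed

lemma half_and_half_run_exists:
  assumes inst: "nw_instance N T s v" and "lam > 0"
  shows "\<exists>z. half_and_half_run N T s v lam z"
proof -
  define P where "P f t w \<longleftrightarrow> (t < T \<longrightarrow> (\<forall>i t'. t' < t \<longrightarrow> i < N \<longrightarrow> t' < T \<longrightarrow> f t' i \<ge> 0) \<longrightarrow>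
     is_arg_max
        (\<lambda>w. \<Sum>i<N. ln (anticipated_utility N s v lam (\<lambda>i t. f t i) i t + v i t * w i))
        (\<lambda>w. (\<forall>i<N. w i \<ge> 0) \<and> (\<Sum>i<N. w i) \<le> s t / 2) w)"
    for f :: "nat \<Rightarrow> nat \<Rightarrow> real" and t and w :: "nat \<Rightarrow> real"
  have "\<exists>f. \<forall>t. P f t (f t)"
  proof (rule dependent_wf_choice[where R = less_than])
    fix f g :: "nat \<Rightarrow> nat \<Rightarrow> real" and t w
    assume "\<And>t'. (t', t) \<in> less_than \<Longrightarrow> f t' = g t'"
    then have eq: "\<And>t'. t' < t \<Longrightarrow> f t' = g t'" by simp
    then have "anticipated_utility N s v lam (\<lambda>i t. f t i) i t =
               anticipated_utility N s v lam (\<lambda>i t. g t i) i t" for i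
      by (auto simp: anticipated_utility_def intro!: sum.cong)
    with eq show "P f t w = P g t w"
      by (simp add: P_def)
  next
    fix t :: nat and f :: "nat \<Rightarrow> nat \<Rightarrow> real"
    show "\<exists>w. P f t w"
    proof (cases "t < T \<and> (\<forall>i t'. t' < t \<longrightarrow> i < N \<longrightarrow> t' < T \<longrightarrow> f t' i \<ge> 0)")
      case True
      let ?u = "\<lambda>i. anticipated_utility N s v lam (\<lambda>i t. f t i) i t"
      let ?A = "\<Sum>j<N. \<Sum>t'\<le>t. v j t' * s t'"
      have nonneg: "v j t' * s t' \<ge> 0" if "j < N" "t' \<le> t" for j t'
        using inst True that by (intro mult_nonneg_nonneg) (auto simp: nw_instance_def less_imp_le)
      have A: "?A \<ge> 0"
        using nonneg by (intro sum_nonneg) auto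
      have "(\<forall>i<N. ?u i > 0) \<or> (\<forall>i<N. v i t = 0)"
      proof (cases "?A = 0")
        case True': True
        have "v i t = 0" if "i < N" for i
        proof -
          have "(\<Sum>t'\<le>t. v i t' * s t') = 0"
            using True' that nonneg by (subst (asm) sum_nonneg_eq_0_iff) (auto intro!: sum_nonneg)
          then have "v i t * s t = 0"
            using that nonneg by (subst (asm) sum_nonneg_eq_0_iff) auto
          with inst True show ?thesis by (auto simp: nw_instance_def)
        qed
        then show ?thesis by blast
      next
        case False
        with A have "?A > 0" by simp
        then have "1 / (2 * lam * real N ^ 2) * ?A > 0"
          using \<open>lam > 0\<close> inst by (intro mult_pos_pos) (auto simp: nw_instance_def)
        moreover have "(\<Sum>t'<t. v i t' * f t' i) \<ge> 0" if "i < N" for i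
          using that inst True by (intro sum_nonneg mult_nonneg_nonneg) (auto simp: nw_instance_def)
        ultimately show ?thesis
          by (auto simp: anticipated_utility_def intro!: add_pos_nonneg)
      qed
      moreover have "s t / 2 \<ge> 0" "\<And>i. i < N \<Longrightarrow> v i t \<ge> 0"
        using inst True by (auto simp: nw_instance_def intro!: less_imp_le)
      ultimately show ?thesis
        using half_and_half_step_exists[of "s t / 2" N "\<lambda>i. v i t" ?u] by (auto simp: P_def)
    qed (auto simp: P_def)
  qed simp
  then obtain f where f: "\<And>t. P f t (f t)" by blast
  have pos: "t < T \<Longrightarrow> \<forall>i<N. f t i \<ge> 0" for t
  proof (induction t rule: less_induct)
    case (less t)
    with f[of t] show ?case by (auto simp: P_def is_arg_max_def)
  qed
  then have "half_and_half_run N T s v lam (\<lambda>i t. f t i)"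
    using f unfolding half_and_half_run_def P_def by auto
  then show ?thesis by blast
qed

lemma guessing_half_and_half_exists:
  assumes "nw_instance N T s v"
  shows "\<exists>D. guessing_half_and_half N T s v D"
proof -
  have "\<exists>z. half_and_half_run N T s v (2 ^ (2 ^ k)) z" for k :: nat
    by (rule half_and_half_run_exists[OF assms]) simp
  then have "\<exists>z. \<forall>k. half_and_half_run N T s v (2 ^ (2 ^ k)) (z k)"
    by metis
  then show ?thesis
    unfolding guessing_half_and_half_def by blast
qed

lemma half_and_half_feasible:
  assumes "nw_instance N T s v" "half_and_half_run N T s v lam z"
  shows "feasible_allocation N T s (half_and_half_allocation N s z)"
  using assms
  by (force simp: nw_instance_def half_and_half_run_def is_arg_max_def feasible_allocation_def
      half_and_half_allocation_def sum.distrib intro!: add_nonneg_nonneg divide_nonneg_nonneg)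

end

theory Submission
  imports Defs
begin

text \<open>
  Fix a run with parameter \<open>lam\<close> at least the balance ratio, let \<open>K = 2 * lam * N\<^sup>2\<close>, let \<open>A\<^sub>t\<close> be the
  total monopolist utility of all agents from the items up to \<open>t\<close>, divided by \<open>K\<close>, and let \<open>Z\<^sub>i\<^sub>t\<close> be
  the utility of agent \<open>i\<close> from the greedy half of these items.  The final utility of agent \<open>i\<close> is at
  least \<open>U\<^sub>i\<^sub>T = A\<^sub>T + Z\<^sub>i\<^sub>T\<close>.  By AM-GM it suffices to bound the average over \<open>i\<close> of \<open>u\<^sub>i / U\<^sub>i\<^sub>T\<close>, where
  \<open>u\<^sub>i\<close> is the utility in a competing allocation.  Put \<open>m = A\<^sub>T / K\<close>.  The items with \<open>A\<^sub>t \<le> m\<close> have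
  total value at most \<open>A\<^sub>T\<close> and so contribute at most 1 to the ratio.  For the other items the
  first-order optimality condition of the greedy step compares the competitor with the greedy
  allocation, up to the factor 2 in the supply, and the gains of the latter relative to
  \<open>U\<^sub>i\<^sub>t \<ge> m + Z\<^sub>i\<^sub>t\<close> telescope to \<open>ln ((m + Z\<^sub>i\<^sub>T) / m) \<le> ln (1 + K\<^sup>2)\<close>.

  For the guess, the least \<open>k\<close> such that \<open>2 ^ 2 ^ k\<close> is at least the balance ratio overshoots it at
  most quadratically, and it is sampled with probability of order \<open>1 / (k + 1)\<^sup>2\<close>.
\<close>

section \<open>AM-GM for utility ratios and optimality of the greedy step\<close>

lemma root_prod_le_of_sum_divide_le:
  fixes a b :: "nat \<Rightarrow> real"
  assumes "N \<ge> 1" and a: "\<And>i. i < N \<Longrightarrow> a i \<ge> 0" and b: "\<And>i. i < N \<Longrightarrow> b i > 0"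
    and le: "(\<Sum>i<N. a i / b i) \<le> G * real N"
  shows "root N (\<Prod>i<N. a i) \<le> G * root N (\<Prod>i<N. b i)"
proof -
  have N: "N > 0" using \<open>N \<ge> 1\<close> by simp
  have nn: "(\<Prod>i<N. a i / b i) \<ge> 0"
    using a b by (intro prod_nonneg) (auto simp: less_imp_le)
  have "root N (\<Prod>i<N. a i / b i) \<le> (\<Sum>i<N. a i / b i / real N)"
    using arith_geom_mean[of "{..<N}" "\<lambda>i. a i / b i"] N a b nn
    by (auto simp: root_powr_inverse less_imp_le lessThan_empty_iff)
  also have "\<dots> \<le> G"
    using le N by (simp only: sum_divide_distrib[symmetric]) (simp add: pos_divide_le_eq)
  finally have "root N (\<Prod>i<N. a i) / root N (\<Prod>i<N. b i) \<le> G"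
    by (simp add: prod_dividef real_root_divide)
  moreover have "root N (\<Prod>i<N. b i) > 0"
    using b N by (intro real_root_gt_zero prod_pos) auto
  ultimately show ?thesis by (simp add: field_simps)
qed

text \<open>The difference of the two sums is the derivative of the objective at \<open>z\<close> in
  the direction \<open>w - z\<close>. If it were positive, a short move from \<open>z\<close>
  towards \<open>w\<close> would stay feasible and improve on the maximizer.\<close>

lemma sum_ln_arg_max_first_order:
  fixes u a z w :: "nat \<Rightarrow> real"
  assumes max: "is_arg_max (\<lambda>w. \<Sum>i<N. ln (u i + a i * w i))
      (\<lambda>w. (\<forall>i<N. w i \<ge> 0) \<and> (\<Sum>i<N. w i) \<le> c) z"
    and pos: "\<And>i. i < N \<Longrightarrow> u i + a i * z i > 0"
    and w: "\<And>i. i < N \<Longrightarrow> w i \<ge> 0" "(\<Sum>i<N. w i) \<le> c"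
  shows "(\<Sum>i<N. a i * w i / (u i + a i * z i)) \<le> (\<Sum>i<N. a i * z i / (u i + a i * z i))"
proof (rule ccontr)
  assume "\<not> ?thesis"
  then have D: "(\<Sum>i<N. a i * (w i - z i) / (u i + a i * z i)) > 0"
    by (simp add: right_diff_distrib diff_divide_distrib sum_subtractf)
  define p where "p h i = z i + h * (w i - z i)" for h i
  have z: "\<forall>i<N. z i \<ge> 0" "(\<Sum>i<N. z i) \<le> c"
    and opt: "\<And>y. \<lbrakk>\<forall>i<N. y i \<ge> 0; (\<Sum>i<N. y i) \<le> c\<rbrakk> \<Longrightarrow>
      (\<Sum>i<N. ln (u i + a i * y i)) \<le> (\<Sum>i<N. ln (u i + a i * z i))"
    using max by (auto simp: is_arg_max_def not_less)
  have "((\<lambda>h. \<Sum>i<N. ln (u i + a i * p h i)) has_real_derivative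
      (\<Sum>i<N. a i * (w i - z i) / (u i + a i * z i))) (at 0)"
    unfolding p_def using pos by (auto intro!: derivative_eq_intros sum.cong)
  from DERIV_pos_inc_right[OF this D] obtain d where d: "d > 0"
    "\<And>h. \<lbrakk>h > 0; h < d\<rbrakk> \<Longrightarrow>
      (\<Sum>i<N. ln (u i + a i * p 0 i)) < (\<Sum>i<N. ln (u i + a i * p h i))"
    by auto
  \<comment> \<open>Below \<open>d\<close> the objective increases; up to 1 the point
    \<open>p h\<close> is a convex combination of \<open>z\<close> and \<open>w\<close>, hence
    feasible.\<close>
  define h where "h = min (d / 2) 1"
  have h: "h > 0" "h < d" "h \<le> 1" using d(1) by (auto simp: h_def)
  have p: "p h i = (1 - h) * z i + h * w i" for i
    by (simp add: p_def algebra_simps)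
  have "\<forall>i<N. p h i \<ge> 0"
    using z w h by (auto simp: p intro!: add_nonneg_nonneg mult_nonneg_nonneg)
  moreover have "(\<Sum>i<N. p h i) \<le> c"
  proof -
    have "(\<Sum>i<N. p h i) = (1 - h) * (\<Sum>i<N. z i) + h * (\<Sum>i<N. w i)"
      by (simp add: p sum.distrib sum_distrib_left)
    also have "\<dots> \<le> (1 - h) * c + h * c"
      using z w h by (intro add_mono mult_left_mono) auto
    finally show ?thesis by (simp add: algebra_simps)
  qed
  ultimately show False
    using opt[of "p h"] d(2)[OF h(1,2)] by (simp add: p_def)
qed

section \<open>Half-and-Half with a parameter at least the balance ratio\<close>

lemma half_and_half_ratio:
  assumes inst: "nw_instance N T s v" and run: "half_and_half_run N T s v lam z"
    and lam: "lam > 0"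
    and Vpos: "\<And>i. i < N \<Longrightarrow> monopolist_utility T s v i > 0"
    and bal: "\<And>i j. \<lbrakk>i < N; j < N\<rbrakk> \<Longrightarrow> monopolist_utility T s v j \<le> lam * monopolist_utility T s v i"
    and x: "feasible_allocation N T s x"
  shows "nash_welfare N T v x
    \<le> (1 + 2 * ln (1 + (2 * lam * real N ^ 2) ^ 2)) *
       nash_welfare N T v (half_and_half_allocation N s z)"
proof -
  define K where "K = 2 * lam * real N ^ 2"
  \<comment> \<open>\<open>A n\<close> and \<open>Z i n\<close> cover the items before
    \<open>n\<close>, so the state right after item \<open>t\<close> is
    \<open>A (Suc t) + Z i (Suc t)\<close>. The anticipated utility already counts item
    \<open>t\<close> in its first term, hence \<open>Suc t\<close> in \<open>A\<close>.\<close>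
  define A where "A n = (\<Sum>j<N. \<Sum>t<n. v j t * s t) / K" for n
  define Z where "Z i n = (\<Sum>t<n. v i t * z i t)" for i n
  \<comment> \<open>This threshold serves both sides: \<open>K * m = A T\<close> pays for the early
    items, and \<open>Z i T / m\<close> is still at most \<open>K ^ 2\<close>, which costs only a
    logarithm.\<close>
  define m where "m = A T / K"
  define late where "late = {t. t < T \<and> A (Suc t) > m}"
  have N: "N > 0" using inst by (simp add: nw_instance_def)
  have v: "v i t \<ge> 0" and s: "s t > 0" if "i < N" "t < T" for i t
    using inst that by (auto simp: nw_instance_def)
  have K: "K > 0" using lam N by (simp add: K_def)
  have z: "z i t \<ge> 0" "(\<Sum>i<N. z i t) \<le> s t / 2" if "i < N" "t < T" for i t
    using run that by (auto simp: half_and_half_run_def is_arg_max_def)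
  have x': "x i t \<ge> 0" "x i t \<le> s t" if "i < N" "t < T" for i t
  proof -
    show "x i t \<ge> 0" using x that by (simp add: feasible_allocation_def)
    have "x i t \<le> (\<Sum>i<N. x i t)"
      using x that by (intro member_le_sum) (auto simp: feasible_allocation_def)
    then show "x i t \<le> s t" using x that by (force simp: feasible_allocation_def)
  qed
  have zs: "z i t \<le> s t" if "i < N" "t < T" for i t
  proof -
    have "z i t \<le> (\<Sum>i<N. z i t)"
      using z that by (intro member_le_sum) auto
    then show ?thesis using z[OF that] s[OF that] by simp
  qed
  have V: "monopolist_utility T s v i = (\<Sum>t<T. v i t * s t)" for i
    by (simp add: monopolist_utility_def mult.commute)
  have AT: "A T = (\<Sum>j<N. monopolist_utility T s v j) / K"
    by (simp add: A_def V)
  have ATpos: "A T > 0"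
    unfolding AT using Vpos K N by (intro divide_pos_pos sum_pos) (auto simp: lessThan_empty_iff)
  then have m: "m > 0" using K by (simp add: m_def)
  have A_mono: "A n \<le> A n'" if "n \<le> n'" "n' \<le> T" for n n'
    unfolding A_def using that K v s
    by (intro divide_right_mono sum_mono sum_mono2) (auto simp: less_imp_le)
  have prefix_le: "(\<Sum>t<n. v i t * s t) \<le> K * A n" if "i < N" "n \<le> T" for i n
  proof -
    have "(\<Sum>t<n. v i t * s t) \<le> (\<Sum>j<N. \<Sum>t<n. v j t * s t)"
      using that v s
      by (intro member_le_sum[of i "{..<N}" "\<lambda>i. \<Sum>t<n. v i t * s t"])
        (auto intro!: sum_nonneg mult_nonneg_nonneg simp: less_imp_le)
    then show ?thesis using K by (simp add: A_def)
  qed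
  have Z_mono: "Z i n \<le> Z i n'" if "i < N" "n \<le> n'" "n' \<le> T" for i n n'
    unfolding Z_def using that v z by (intro sum_mono2) auto
  have Z0: "Z i n \<ge> 0" if "i < N" "n \<le> T" for i n
    using Z_mono[of i 0 n] that by (simp add: Z_def)
  have U: "anticipated_utility N s v lam z i t + v i t * z i t = A (Suc t) + Z i (Suc t)" for i t
    by (simp add: anticipated_utility_def A_def Z_def K_def lessThan_Suc_atMost[symmetric])
  have lateT: "t < T" and late: "A (Suc t) > m" if "t \<in> late" for t
    using that by (auto simp: late_def)

  have step: "(\<Sum>i<N. v i t * x i t / (A (Suc t) + Z i (Suc t)))
      \<le> 2 * (\<Sum>i<N. v i t * z i t / (A (Suc t) + Z i (Suc t)))" if t: "t \<in> late" for t
  proof -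
    \<comment> \<open>The greedy half distributes only \<open>s t / 2\<close>, so the competitor is
      halved to become feasible.\<close>
    have "(\<Sum>i<N. v i t * (x i t / 2) / (A (Suc t) + Z i (Suc t)))
      \<le> (\<Sum>i<N. v i t * z i t / (A (Suc t) + Z i (Suc t)))"
      unfolding U[symmetric]
    proof (rule sum_ln_arg_max_first_order)
      show "is_arg_max (\<lambda>w. \<Sum>i<N. ln (anticipated_utility N s v lam z i t + v i t * w i))
          (\<lambda>w. (\<forall>i<N. w i \<ge> 0) \<and> (\<Sum>i<N. w i) \<le> s t / 2) (\<lambda>i. z i t)"
        using run lateT[OF t] by (simp add: half_and_half_run_def)
      show "anticipated_utility N s v lam z i t + v i t * z i t > 0" if "i < N" for i
        unfolding U using late[OF t] lateT[OF t] m Z0[OF that, of "Suc t"] by simp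
      show "(\<Sum>i<N. x i t / 2) \<le> s t / 2"
        using x lateT[OF t] by (simp add: sum_divide_distrib[symmetric] feasible_allocation_def)
    qed (use x' lateT[OF t] in auto)
    moreover have "(\<Sum>i<N. v i t * (x i t / 2) / (A (Suc t) + Z i (Suc t)))
      = (\<Sum>i<N. v i t * x i t / (A (Suc t) + Z i (Suc t))) / 2"
      by (simp add: sum_divide_distrib mult.commute)
    ultimately show ?thesis by simp
  qed

  have potential: "(\<Sum>t\<in>late. v i t * z i t / (A (Suc t) + Z i (Suc t))) \<le> ln (1 + K ^ 2)"
    if i: "i < N" for i
  proof -
    have "(\<Sum>t\<in>late. v i t * z i t / (A (Suc t) + Z i (Suc t)))
        \<le> (\<Sum>t\<in>late. ln (m + Z i (Suc t)) - ln (m + Z i t))"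
    proof (rule sum_mono)
      fix t assume t: "t \<in> late"
      note Z = Z0[OF i, of t] Z0[OF i, of "Suc t"]
      \<comment> \<open>Lowering \<open>A (Suc t)\<close> to the constant \<open>m\<close> leaves
        denominators that change only through \<open>Z\<close>, so that the logarithms can
        telescope.\<close>
      have "v i t * z i t / (A (Suc t) + Z i (Suc t)) \<le> v i t * z i t / (m + Z i (Suc t))"
        using late[OF t] lateT[OF t] m Z v[OF i] z(1)[OF i]
        by (intro divide_left_mono) auto
      moreover have "ln (m + Z i t) - ln (m + Z i (Suc t))
          \<le> ((m + Z i t) - (m + Z i (Suc t))) / (m + Z i (Suc t))"
        using m Z lateT[OF t] by (intro ln_diff_le) auto
      moreover have "(m + Z i t) - (m + Z i (Suc t)) = - (v i t * z i t)"
        by (simp add: Z_def)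
      ultimately show "v i t * z i t / (A (Suc t) + Z i (Suc t))
          \<le> ln (m + Z i (Suc t)) - ln (m + Z i t)"
        by simp
    qed
    \<comment> \<open>Telescoping needs consecutive items; the added early terms are nonnegative
      because \<open>Z i\<close> is nondecreasing.\<close>
    also have "\<dots> \<le> (\<Sum>t<T. ln (m + Z i (Suc t)) - ln (m + Z i t))"
      using m Z0[OF i] Z_mono[OF i] by (intro sum_mono2) (auto simp: late_def add_pos_nonneg)
    also have "\<dots> = ln (m + Z i T) - ln m"
      by (subst sum_lessThan_telescope) (simp add: Z_def)
    also have "\<dots> = ln ((m + Z i T) / m)"
      using m Z0[OF i, of T] by (subst ln_div) auto
    also have "\<dots> = ln (1 + Z i T / m)"
      using m by (simp add: add_divide_distrib)
    also have "\<dots> \<le> ln (1 + K ^ 2)"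
    proof -
      have "Z i T \<le> (\<Sum>t<T. v i t * s t)"
        unfolding Z_def using v[OF i] zs[OF i] by (intro sum_mono mult_left_mono) auto
      also have "\<dots> \<le> K * A T" using prefix_le[OF i] by simp
      also have "\<dots> = K ^ 2 * m" using K by (simp add: m_def power2_eq_square)
      finally have "Z i T / m \<le> K ^ 2" using m by (simp add: field_simps)
      moreover have "Z i T / m \<ge> 0" using m Z0[OF i] by simp
      ultimately show ?thesis by simp
    qed
    finally show ?thesis .
  qed

  have early: "(\<Sum>t\<in>{..<T} - late. v i t * x i t) \<le> A T" if i: "i < N" for i
  proof (cases "{..<T} - late = {}")
    case False
    \<comment> \<open>All early items are among the first \<open>Suc r\<close>, whose total value is
      at most \<open>K * A (Suc r)\<close>, and \<open>A (Suc r) \<le> m\<close> since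
      \<open>r\<close> is itself early.\<close>
    define r where "r = Max ({..<T} - late)"
    have "r \<in> {..<T} - late" using False unfolding r_def by (intro Max_in) auto
    then have r: "r < T" "A (Suc r) \<le> m" by (auto simp: late_def)
    have "(\<Sum>t\<in>{..<T} - late. v i t * x i t) \<le> (\<Sum>t<Suc r. v i t * x i t)"
      using r v[OF i] x'[OF i]
      by (intro sum_mono2) (auto simp: r_def less_Suc_eq_le intro: Max_ge)
    also have "\<dots> \<le> (\<Sum>t<Suc r. v i t * s t)"
      using r v[OF i] x'[OF i] by (intro sum_mono mult_left_mono) auto
    also have "\<dots> \<le> K * A (Suc r)" using r by (intro prefix_le[OF i]) auto
    also have "\<dots> \<le> K * m" using r K by simp
    also have "\<dots> = A T" using K by (simp add: m_def)
    finally show ?thesis .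
  next
    case True
    then show ?thesis using ATpos by (simp only: sum.empty)
  qed

  have ratio: "utility T v x i / (A T + Z i T)
      \<le> 1 + (\<Sum>t\<in>late. v i t * x i t / (A (Suc t) + Z i (Suc t)))" if i: "i < N" for i
  proof -
    have UT: "A T + Z i T > 0" using ATpos Z0[OF i, of T] by simp
    have "utility T v x i = (\<Sum>t\<in>{..<T} - late. v i t * x i t) + (\<Sum>t\<in>late. v i t * x i t)"
      unfolding utility_def
      by (subst sum.subset_diff[of late]) (auto simp: late_def mult.commute)
    then have "utility T v x i / (A T + Z i T)
        = (\<Sum>t\<in>{..<T} - late. v i t * x i t) / (A T + Z i T)
          + (\<Sum>t\<in>late. v i t * x i t / (A T + Z i T))"
      by (simp add: add_divide_distrib sum_divide_distrib)
    also have "\<dots> \<le> 1 + (\<Sum>t\<in>late. v i t * x i t / (A (Suc t) + Z i (Suc t)))"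
    proof (intro add_mono sum_mono)
      show "(\<Sum>t\<in>{..<T} - late. v i t * x i t) / (A T + Z i T) \<le> 1"
        using early[OF i] Z0[OF i, of T] UT by simp
      fix t assume t: "t \<in> late"
      have "A (Suc t) + Z i (Suc t) > 0"
        using late[OF t] lateT[OF t] m Z0[OF i, of "Suc t"] by simp
      moreover have "A (Suc t) + Z i (Suc t) \<le> A T + Z i T"
        using lateT[OF t] A_mono Z_mono[OF i] by (intro add_mono) auto
      ultimately show "v i t * x i t / (A T + Z i T) \<le> v i t * x i t / (A (Suc t) + Z i (Suc t))"
        using v[OF i lateT[OF t]] x'[OF i lateT[OF t]] by (intro divide_left_mono) auto
    qed
    finally show ?thesis .
  qed

  \<comment> \<open>The equal split alone gives agent \<open>i\<close> its monopolist utility over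
    \<open>2 * N\<close>. This is at least \<open>A T\<close> because \<open>lam\<close> dominates
    the balance ratio; no other step uses \<open>bal\<close>.\<close>
  have util: "utility T v (half_and_half_allocation N s z) i \<ge> A T + Z i T" if i: "i < N" for i
  proof -
    have "A T \<le> (\<Sum>j<N. lam * monopolist_utility T s v i) / K"
      unfolding AT using bal i K by (intro divide_right_mono sum_mono) auto
    also have "\<dots> = monopolist_utility T s v i / (2 * real N)"
      using N lam by (simp add: K_def power2_eq_square)
    finally have "A T \<le> monopolist_utility T s v i / (2 * real N)" .
    moreover have "utility T v (half_and_half_allocation N s z) i
        = monopolist_utility T s v i / (2 * real N) + Z i T"
      by (simp add: utility_def half_and_half_allocation_def Z_def V algebra_simps sum.distrib
          sum_divide_distrib)
    ultimately show ?thesis by simp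
  qed

  have "root N (\<Prod>i<N. utility T v x i)
    \<le> (1 + 2 * ln (1 + K ^ 2)) * root N (\<Prod>i<N. utility T v (half_and_half_allocation N s z) i)"
  proof (rule root_prod_le_of_sum_divide_le)
    show ux: "utility T v x i \<ge> 0" if "i < N" for i
      using that v x' by (auto simp: utility_def intro!: sum_nonneg)
    show ua: "utility T v (half_and_half_allocation N s z) i > 0" if "i < N" for i
      using util[OF that] ATpos Z0[OF that, of T] by simp
    have "(\<Sum>i<N. utility T v x i / utility T v (half_and_half_allocation N s z) i)
        \<le> (\<Sum>i<N. 1 + (\<Sum>t\<in>late. v i t * x i t / (A (Suc t) + Z i (Suc t))))"
    proof (rule sum_mono)
      fix i assume "i \<in> {..<N}"
      then have i: "i < N" by simp
      have "utility T v x i / utility T v (half_and_half_allocation N s z) i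
          \<le> utility T v x i / (A T + Z i T)"
        using util[OF i] ux[OF i] ua[OF i] ATpos Z0[OF i, of T] by (intro divide_left_mono) auto
      also note ratio[OF i]
      finally show "utility T v x i / utility T v (half_and_half_allocation N s z) i
          \<le> 1 + (\<Sum>t\<in>late. v i t * x i t / (A (Suc t) + Z i (Suc t)))" .
    qed
    \<comment> \<open>The sums are exchanged twice: \<open>step\<close> compares all agents at one
      item, whereas \<open>potential\<close> follows one agent through all late items.\<close>
    also have "\<dots> = real N + (\<Sum>t\<in>late. \<Sum>i<N. v i t * x i t / (A (Suc t) + Z i (Suc t)))"
      by (simp add: sum.distrib sum.swap[of _ late])
    also have "\<dots> \<le> real N + (\<Sum>t\<in>late. 2 * (\<Sum>i<N. v i t * z i t / (A (Suc t) + Z i (Suc t))))"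
      using step by (intro add_left_mono sum_mono) auto
    also have "\<dots> = real N + 2 * (\<Sum>i<N. \<Sum>t\<in>late. v i t * z i t / (A (Suc t) + Z i (Suc t)))"
      by (simp add: sum.swap[of _ late] sum_distrib_left)
    also have "\<dots> \<le> real N + 2 * (\<Sum>i<N. ln (1 + K ^ 2))"
      using potential by (intro add_left_mono mult_left_mono sum_mono) auto
    also have "\<dots> = (1 + 2 * ln (1 + K ^ 2)) * real N"
      by (simp add: algebra_simps)
    finally show "(\<Sum>i<N. utility T v x i / utility T v (half_and_half_allocation N s z) i)
        \<le> (1 + 2 * ln (1 + K ^ 2)) * real N" .
  qed (use N in simp)
  then show ?thesis by (simp add: nash_welfare_def K_def)
qed

section \<open>Bounds on the optimum and on the expectation\<close>

lemma nash_welfare_nonneg: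
  assumes "nw_instance N T s v" "feasible_allocation N T s x"
  shows "nash_welfare N T v x \<ge> 0"
  using assms unfolding nash_welfare_def utility_def nw_instance_def feasible_allocation_def
  by (auto intro!: prod_nonneg sum_nonneg)

lemma opt_nash_welfare_le:
  assumes inst: "nw_instance N T s v"
    and le: "\<And>x. feasible_allocation N T s x \<Longrightarrow> nash_welfare N T v x \<le> b"
  shows "opt_nash_welfare N T s v \<le> b"
proof -
  have "feasible_allocation N T s (\<lambda>_ _. 0)"
    using inst by (auto simp: feasible_allocation_def nw_instance_def less_imp_le)
  then show ?thesis
    unfolding opt_nash_welfare_def by (intro cSUP_least) (auto intro: le)
qed

text \<open>For the degenerate instances, on which \<open>balance_ratio\<close> is 0 by division by
  zero and bounds nothing.\<close>

lemma nash_welfare_eq_0: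
  assumes inst: "nw_instance N T s v" and x: "feasible_allocation N T s x"
    and i: "i < N" "monopolist_utility T s v i = 0"
  shows "nash_welfare N T v x = 0"
proof -
  have "v i t = 0" if "t < T" for t
  proof -
    have "\<forall>t\<in>{..<T}. s t * v i t = 0"
      using i inst unfolding monopolist_utility_def
      by (subst (asm) sum_nonneg_eq_0_iff) (auto simp: nw_instance_def less_imp_le)
    then have "s t * v i t = 0" using that by blast
    then show ?thesis using inst that by (auto simp: nw_instance_def)
  qed
  then have "utility T v x i = 0" by (simp add: utility_def)
  then have "(\<Prod>i<N. utility T v x i) = 0" using i(1) by (intro prod_zero) auto
  then show ?thesis by (simp only: nash_welfare_def real_root_zero)
qed

text \<open>Allows all guesses but one to be discarded. The bound \<open>B\<close> is there for
  integrability; the optimum will play this role.\<close>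

lemma pmf_mult_le_expectation:
  fixes f :: "nat \<Rightarrow> real"
  assumes "\<And>k. 0 \<le> f k" "\<And>k. f k \<le> B"
  shows "pmf p k * f k \<le> measure_pmf.expectation p f"
proof -
  have "pmf p k * f k = measure_pmf.expectation p (\<lambda>j. f k * indicator {k} j)"
    by (simp add: measure_pmf_single)
  also have "\<dots> \<le> measure_pmf.expectation p f"
  proof (rule integral_mono)
    show "integrable (measure_pmf p) (\<lambda>j. f k * indicator {k} j :: real)"
      by (rule measure_pmf.integrable_const_bound[where B = "f k"])
        (use assms in \<open>auto simp: indicator_def\<close>)
    show "integrable (measure_pmf p) f"
      by (rule measure_pmf.integrable_const_bound[where B = B]) (use assms in auto)
  qed (use assms in \<open>auto simp: indicator_def\<close>)
  finally show ?thesis .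
qed

section \<open>Size and probability of a suitable guess\<close>

lemma log_bound_ge_1: "log_bound x \<ge> 1"
  and ln_le_log_bound: "ln x \<le> log_bound x"
  by (auto simp: log_bound_def)

text \<open>Take the least \<open>k\<close> with \<open>r \<le> 2 ^ 2 ^ k\<close>. If
  \<open>k = Suc j\<close>, minimality gives \<open>2 ^ j * ln 2 < ln r\<close>; one factor 2 comes
  from \<open>ln 2 \<ge> 1 / 2\<close>, the other from passing from \<open>j\<close> to
  \<open>k\<close>.\<close>

lemma exists_guess:
  fixes r :: real
  shows "\<exists>k::nat. r \<le> 2 ^ 2 ^ k \<and> 2 ^ k \<le> 4 * log_bound r"
proof -
  have "\<exists>k::nat. r \<le> 2 ^ 2 ^ k"
  proof -
    obtain n :: nat where n: "r < 2 ^ n"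
      using real_arch_pow[of 2 r] by auto
    also have "(2::real) ^ n \<le> 2 ^ 2 ^ n"
      by (intro power_increasing) (auto intro: less_imp_le less_exp)
    finally show ?thesis by (auto intro: less_imp_le)
  qed
  define k :: nat where "k = (LEAST k. r \<le> 2 ^ 2 ^ k)"
  have k: "r \<le> 2 ^ 2 ^ k"
    unfolding k_def using \<open>\<exists>k::nat. r \<le> 2 ^ 2 ^ k\<close> by (rule LeastI_ex)
  moreover have "2 ^ k \<le> 4 * log_bound r"
  proof (cases k)
    case 0
    then show ?thesis using log_bound_ge_1[of r] by simp
  next
    case (Suc j)
    have "\<not> r \<le> 2 ^ 2 ^ j"
      using Suc not_less_Least[of j "\<lambda>k. r \<le> 2 ^ 2 ^ k"] by (simp add: k_def)
    moreover have "(0 :: real) < 2 ^ 2 ^ j" by simp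
    ultimately have "ln (2 ^ 2 ^ j) \<le> ln r" by (subst ln_le_cancel_iff) linarith+
    then have "2 ^ j * ln 2 \<le> log_bound r"
      using ln_le_log_bound[of r] by (simp add: ln_realpow)
    moreover have "2 ^ j * (1 / 2) \<le> (2 :: real) ^ j * ln 2"
      using ln2_ge_two_thirds by (intro mult_left_mono) auto
    ultimately have "2 ^ j * (1 / 2) \<le> log_bound r" by linarith
    then show ?thesis by (simp add: Suc)
  qed
  ultimately show ?thesis by blast
qed

lemma ln_guess_bound:
  assumes N: "N \<ge> 1" and r: "r \<ge> 1" and k: "2 ^ k \<le> 4 * log_bound r"
  shows "1 + 2 * ln (1 + (2 * 2 ^ 2 ^ k * real N ^ 2) ^ 2) \<le> 31 * log_bound (r * real N)"
proof -
  define K where "K = 2 * 2 ^ 2 ^ k * real N ^ 2"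
  have rN: "r \<le> r * real N" "real N \<le> r * real N"
    using N r by (auto simp: mult_le_cancel_left1 mult_le_cancel_right1)
  have "ln r \<le> ln (r * real N)" "ln (real N) \<le> ln (r * real N)"
    using rN N r by auto
  then have B: "log_bound r \<le> log_bound (r * real N)" "ln (real N) \<le> log_bound (r * real N)"
    by (auto simp: log_bound_def)
  have ln2: "0 \<le> ln (2::real)" "ln (2::real) \<le> 1" using ln2_le_25_over_36 by auto
  have K1: "K \<ge> 1"
    unfolding K_def using N by (auto intro!: mult_ge1_I[of "_ :: real"] simp: one_le_power)
  have "ln (1 + K ^ 2) \<le> ln (2 * K ^ 2)"
    using K1 by (subst ln_le_cancel_iff) (auto simp: one_le_power add_pos_pos)
  also have "\<dots> = 3 * ln 2 + 2 * (2 ^ k * ln 2) + 4 * ln (real N)"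
  proof -
    have "ln (2 * K ^ 2) = ln 2 + 2 * ln K" using K1 by (simp add: ln_mult ln_realpow)
    moreover have "ln K = ln 2 + 2 ^ k * ln 2 + 2 * ln (real N)"
      using N by (simp only: K_def) (simp add: ln_mult ln_realpow)
    ultimately show ?thesis by simp
  qed
  also have "\<dots> \<le> 3 * 1 + 2 * (2 ^ k * 1) + 4 * ln (real N)"
    using ln2 by (intro add_mono mult_left_mono) auto
  \<comment> \<open>The 15 is 3 + 2 * 4 + 4, by the hypothesis on \<open>2 ^ k\<close>; the final 31
    is 1 + 2 * 15.\<close>
  also have "\<dots> \<le> 15 * log_bound (r * real N)"
    using k B log_bound_ge_1[of "r * real N"] by linarith
  finally show ?thesis
    using log_bound_ge_1[of "r * real N"] by (simp add: K_def)
qed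

text \<open>Controls the inverse probability of the guess. Taking logarithms in the hypothesis and
  using \<open>2 * ln 2 \<ge> 1\<close> gives \<open>k \<le> 2 + 2 * L\<close>, and
  \<open>L \<ge> 1\<close> absorbs the constants into \<open>5 * L\<close>.\<close>

lemma guess_index_bound:
  assumes k: "2 ^ k \<le> 4 * log_bound r"
  shows "(real k + 1) ^ 2 \<le> 25 * log_bound (log_bound r) ^ 2"
proof -
  define L where "L = log_bound (log_bound r)"
  have pos: "log_bound r > 0" using log_bound_ge_1[of r] by simp
  have "ln (2 ^ k) \<le> ln (4 * log_bound r)"
    using k pos by (subst ln_le_cancel_iff) auto
  also have "\<dots> = ln (2 ^ 2) + ln (log_bound r)"
    using pos by (simp add: ln_mult)
  also have "\<dots> = 2 * ln 2 + ln (log_bound r)"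
    by (simp only: ln_realpow zero_less_numeral of_nat_numeral)
  also have "\<dots> \<le> 2 * ln 2 + L"
    using ln_le_log_bound by (simp add: L_def)
  finally have "real k * ln 2 \<le> 2 * ln 2 + L" by (simp add: ln_realpow)
  moreover have "L * 1 \<le> L * (2 * ln 2)"
    using ln2_ge_two_thirds log_bound_ge_1[of "log_bound r"]
    by (intro mult_left_mono) (auto simp: L_def)
  ultimately have "real k * ln 2 \<le> (2 + 2 * L) * ln 2" by (simp add: algebra_simps)
  then have "real k \<le> 2 + 2 * L" by (rule mult_right_le_imp_le) simp
  then have "real k + 1 \<le> 5 * L" using log_bound_ge_1[of "log_bound r"] by (simp add: L_def)
  then have "(real k + 1) ^ 2 \<le> (5 * L) ^ 2" by (intro power_mono) auto
  then show ?thesis by (simp add: L_def power_mult_distrib)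
qed

section \<open>The balance ratio and the competitive bound\<close>

lemma balance_ratio_bounds:
  assumes "N \<ge> 1" and Vpos: "\<forall>i<N. monopolist_utility T s v i > 0"
  shows "balance_ratio N T s v \<ge> 1"
    and "\<lbrakk>i < N; j < N\<rbrakk> \<Longrightarrow>
      monopolist_utility T s v j \<le> balance_ratio N T s v * monopolist_utility T s v i"
proof -
  let ?I = "monopolist_utility T s v ` {..<N}"
  have I: "finite ?I" "?I \<noteq> {}" using \<open>N \<ge> 1\<close> by (auto simp: lessThan_empty_iff)
  then have min: "Min ?I > 0" using Vpos by (subst Min_gr_iff) auto
  moreover have "Min ?I \<le> Max ?I" using I by (meson Max_ge Min_in)
  ultimately show ge: "balance_ratio N T s v \<ge> 1" by (simp add: balance_ratio_def)
  assume ij: "i < N" "j < N"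
  have "monopolist_utility T s v j \<le> Max ?I" using I ij by (intro Max_ge) auto
  also have "\<dots> = balance_ratio N T s v * Min ?I" using min by (simp add: balance_ratio_def)
  also have "\<dots> \<le> balance_ratio N T s v * monopolist_utility T s v i"
    using I ij ge by (intro mult_left_mono Min_le) auto
  finally show "monopolist_utility T s v j
    \<le> balance_ratio N T s v * monopolist_utility T s v i" .
qed

text \<open>The factor 31 is the loss of Half-and-Half under the good guess \<open>k\<close>
  (\<open>ln_guess_bound\<close>), 25 comes from bounding \<open>(k + 1) ^ 2\<close>, and
  \<open>pi ^ 2 / 6\<close> inverts the normalization of \<open>guess_pmf\<close>.\<close>

lemma guessing_half_and_half_bound:
  assumes inst: "nw_instance N T s v" and D: "guessing_half_and_half N T s v D"
  defines "r \<equiv> balance_ratio N T s v"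
  shows "opt_nash_welfare N T s v
    \<le> 31 * 25 * pi ^ 2 / 6 * (log_bound (r * real N) * log_bound (log_bound r) ^ 2) *
       measure_pmf.expectation D (nash_welfare N T v)"
proof -
  obtain z where z: "\<And>k. half_and_half_run N T s v (2 ^ 2 ^ k) (z k)"
    and D: "D = map_pmf (\<lambda>k. half_and_half_allocation N s (z k)) guess_pmf"
    using D by (auto simp: guessing_half_and_half_def)
  define W where "W k = nash_welfare N T v (half_and_half_allocation N s (z k))" for k
  define E where "E = measure_pmf.expectation D (nash_welfare N T v)"
  have E: "E = measure_pmf.expectation guess_pmf W"
    by (simp add: E_def D W_def[abs_def])
  have W: "0 \<le> W k" "W k \<le> opt_nash_welfare N T s v" for k
    unfolding W_def using half_and_half_feasible[OF inst z]
    by (auto intro: nash_welfare_nonneg[OF inst] nash_welfare_le_opt[OF inst])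
  have E0: "E \<ge> 0" unfolding E using W by (intro integral_nonneg_AE) auto
  have L: "log_bound y \<ge> 0" for y using log_bound_ge_1[of y] by simp
  have N: "N \<ge> 1" using inst by (simp add: nw_instance_def)
  have "opt_nash_welfare N T s v
    \<le> 31 * 25 * pi ^ 2 / 6 * (log_bound (r * real N) * log_bound (log_bound r) ^ 2) * E"
  proof (cases "\<forall>i<N. monopolist_utility T s v i > 0")
    case False
    then obtain i where i: "i < N" "monopolist_utility T s v i \<le> 0" by auto
    moreover have "monopolist_utility T s v i \<ge> 0"
      using inst i unfolding monopolist_utility_def
      by (intro sum_nonneg mult_nonneg_nonneg) (auto simp: nw_instance_def less_imp_le)
    ultimately have "monopolist_utility T s v i = 0" by simp
    then have "opt_nash_welfare N T s v \<le> 0"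
      using nash_welfare_eq_0[OF inst _ i(1)] by (intro opt_nash_welfare_le[OF inst]) auto
    also have "0 \<le> 31 * 25 * pi ^ 2 / 6 * (log_bound (r * real N) * log_bound (log_bound r) ^ 2) * E"
      using E0 L by simp
    finally show ?thesis .
  next
    case True
    then have Vpos: "\<And>i. i < N \<Longrightarrow> monopolist_utility T s v i > 0" by blast
    note r = balance_ratio_bounds[OF N True, folded r_def]
    obtain k where k: "r \<le> 2 ^ 2 ^ k" "2 ^ k \<le> 4 * log_bound r"
      using exists_guess by blast
    have bal: "monopolist_utility T s v j \<le> 2 ^ 2 ^ k * monopolist_utility T s v i"
      if ij: "i < N" "j < N" for i j
    proof -
      note r(2)[OF ij]
      also have "r * monopolist_utility T s v i \<le> 2 ^ 2 ^ k * monopolist_utility T s v i"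
        using k(1) Vpos[OF ij(1)] by (intro mult_right_mono) auto
      finally show ?thesis .
    qed
    have opt: "opt_nash_welfare N T s v \<le> 31 * log_bound (r * real N) * W k"
    proof (rule opt_nash_welfare_le[OF inst])
      fix x assume "feasible_allocation N T s x"
      then have "nash_welfare N T v x \<le> (1 + 2 * ln (1 + (2 * 2 ^ 2 ^ k * real N ^ 2) ^ 2)) * W k"
        unfolding W_def by (intro half_and_half_ratio[OF inst z _ Vpos bal]) auto
      also have "\<dots> \<le> 31 * log_bound (r * real N) * W k"
        using ln_guess_bound[OF N r(1) k(2)] W(1) by (intro mult_right_mono)
      finally show "nash_welfare N T v x \<le> 31 * log_bound (r * real N) * W k" .
    qed
    have "6 / pi ^ 2 * (1 / (real k + 1) ^ 2) * W k \<le> E"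
      using pmf_mult_le_expectation[of W _ guess_pmf k, OF W] unfolding E pmf_guess_pmf .
    then have "W k \<le> pi ^ 2 / 6 * E * (real k + 1) ^ 2"
      by (simp add: field_simps)
    also have "\<dots> \<le> pi ^ 2 / 6 * E * (25 * log_bound (log_bound r) ^ 2)"
      using guess_index_bound[OF k(2)] E0 by (intro mult_left_mono) auto
    finally have "31 * log_bound (r * real N) * W k
        \<le> 31 * log_bound (r * real N) * (pi ^ 2 / 6 * E * (25 * log_bound (log_bound r) ^ 2))"
      using L by (intro mult_left_mono) auto
    with opt show ?thesis by (simp add: mult_ac)
  qed
  then show ?thesis by (simp add: E_def)
qed

theorem theorem2:
  shows "\<exists>C. competitive
     (\<lambda>N T s v. C * (log_bound (balance_ratio N T s v * real N) *
                      (log_bound (log_bound (balance_ratio N T s v))) ^ 2))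
     guessing_half_and_half"
  unfolding competitive_def using guessing_half_and_half_bound by blast

end
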